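(* Let $E$ and $F$ be two ordered vector spaces with $F$ a Dedekind complete Riesz space. If $G$ is a majorizing vector subspace of $E$ and $T : G \to F$ is a monotone sublinear operator, then $T$ has a positive sublinear extension to all of $E$.
   Context: A Riesz space (vector lattice) is a real ordered vector space in which every pair of elements has a supremum and an infimum. It is Dedekind complete if every nonempty subset that is bounded above has a supremum. A vector subspace $G$ of an ordered vector space $E$ is majorizing $E$ if for each $x\in E$ there exists some $y\in G$ with $x\le y$ (equivalently, for each $x\in E$ there exists some $y\in G$ with $y\le x$). A mapping $T:E\to F$ between ordered vector spaces is called sublinear if $T(x+y)\le T(x)+T(y)$ and $T(\lambda x)=\lambda T(x)$ for all $x,y\in E$ and all real $\lambda\ge 0$. It is called monotone if $x\ge y$ implies $T(x)\ge T(y)$. It is called positive if $x\ge 0$ implies $T(x)\ge 0$. The subspace $G$ carries the order induced from $E$. *)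

theory Defs
  imports Complex_Main
begin

definition majorizing :: "'a::ord set \<Rightarrow> bool"
  where "majorizing G \<longleftrightarrow> (\<forall>x. \<exists>y\<in>G. x \<le> y)"

(* Operators defined on a subspace G are represented by total functions that are
   only constrained on G. *)
definition sublinear_on :: "'a::real_vector set \<Rightarrow> ('a \<Rightarrow> 'b::ordered_real_vector) \<Rightarrow> bool"
  where "sublinear_on G T \<longleftrightarrow>
    (\<forall>x\<in>G. \<forall>y\<in>G. T (x + y) \<le> T x + T y) \<and>
    (\<forall>x\<in>G. \<forall>c\<ge>0. T (c *\<^sub>R x) = c *\<^sub>R T x)"

definition positive_on :: "'a::ordered_real_vector set \<Rightarrow> ('a \<Rightarrow> 'b::ordered_real_vector) \<Rightarrow> bool"
  where "positive_on G T \<longleftrightarrow> (\<forall>x\<in>G. 0 \<le> x \<longrightarrow> 0 \<le> T x)"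

end

theory Submission
  imports Defs
begin

text \<open>
  The extension is the largest monotone one: \<open>S x\<close> is the infimum of the values \<open>T y\<close> over all
  \<open>y \<in> G\<close> above \<open>x\<close>. Majorization is used twice: it supplies some \<open>y \<in> G\<close> above \<open>x\<close>,
  so that the set of values is nonempty, and, applied to \<open>- x\<close>, some \<open>z \<in> G\<close> below \<open>x\<close>, so that
  by monotonicity \<open>T z\<close> bounds the set from below. Dedekind completeness then gives the
  infimum. For \<open>x \<in> G\<close> the infimum is attained at \<open>y = x\<close>, so \<open>S\<close> extends \<open>T\<close>; for \<open>0 \<le> x\<close> all
  the values are at least \<open>T 0 = 0\<close>, so \<open>S\<close> is positive; and \<open>S\<close> inherits sublinearity because
  majorants of vectors can be added and scaled by positive reals.
\<close>

definition majorant_extension :: "'e::ord set \<Rightarrow> ('e \<Rightarrow> 'f::Inf) \<Rightarrow> 'e \<Rightarrow> 'f"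
  where "majorant_extension G T x = Inf (T ` {y \<in> G. x \<le> y})"

lemma majorizing_obtains_minorant:
  fixes G :: "'e::ordered_real_vector set"
  assumes "subspace G" "majorizing G"
  obtains z where "z \<in> G" "z \<le> x"
proof -
  obtain w where "w \<in> G" "- x \<le> w"
    using assms(2) unfolding majorizing_def by blast
  then show thesis
    using that[of "- w"] subspace_neg[OF assms(1)] by (simp add: minus_le_iff)
qed

lemma majorant_extension_lower:
  fixes G :: "'e::ordered_real_vector set"
    and T :: "'e \<Rightarrow> 'f::conditionally_complete_lattice"
  assumes "subspace G" "majorizing G" "mono_on G T" "y \<in> G" "x \<le> y"
  shows "majorant_extension G T x \<le> T y"
proof -
  obtain z where "z \<in> G" "z \<le> x"
    using majorizing_obtains_minorant[OF assms(1,2)] .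
  then have "bdd_below (T ` {y \<in> G. x \<le> y})"
    by (intro bdd_belowI2[of _ "T z"]) (auto intro!: mono_onD[OF assms(3)] intro: order_trans)
  then show ?thesis
    unfolding majorant_extension_def using assms(4,5) by (intro cInf_lower) auto
qed

lemma majorant_extension_greatest:
  fixes T :: "'e::ord \<Rightarrow> 'f::conditionally_complete_lattice"
  assumes "majorizing G" "\<And>y. y \<in> G \<Longrightarrow> x \<le> y \<Longrightarrow> b \<le> T y"
  shows "b \<le> majorant_extension G T x"
  using assms unfolding majorant_extension_def majorizing_def
  by (intro cInf_greatest) auto

lemma majorant_extension_eq_on:
  fixes G :: "'e::ordered_real_vector set"
    and T :: "'e \<Rightarrow> 'f::conditionally_complete_lattice"
  assumes "subspace G" "majorizing G" "mono_on G T" "x \<in> G"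
  shows "majorant_extension G T x = T x"
  using assms
  by (intro antisym majorant_extension_lower majorant_extension_greatest)
    (auto intro: mono_onD)

lemma sublinear_on_zero:
  assumes "subspace G" "sublinear_on G T"
  shows "T 0 = 0"
proof -
  have "T (0 *\<^sub>R 0) = 0 *\<^sub>R T 0"
    using assms(2) subspace_0[OF assms(1)] unfolding sublinear_on_def by blast
  then show ?thesis by simp
qed

lemma majorant_extension_add_le:
  fixes G :: "'e::ordered_real_vector set"
    and T :: "'e \<Rightarrow> 'f::{ordered_real_vector, conditionally_complete_lattice}"
  assumes "subspace G" "majorizing G" "mono_on G T" "sublinear_on G T"
  shows "majorant_extension G T (x + y) \<le> majorant_extension G T x + majorant_extension G T y"
proof -
  let ?S = "majorant_extension G T"
  have "?S (x + y) \<le> T a + T b" if "a \<in> G" "x \<le> a" "b \<in> G" "y \<le> b" for a b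
  proof -
    have "?S (x + y) \<le> T (a + b)"
      using that by (intro majorant_extension_lower assms subspace_add add_mono)
    also have "\<dots> \<le> T a + T b"
      using that assms(4) unfolding sublinear_on_def by blast
    finally show ?thesis .
  qed
  \<comment> \<open>Take the infimum over \<open>a\<close> first, with \<open>b\<close> fixed, and then over \<open>b\<close>.\<close>
  then have "?S (x + y) - T b \<le> ?S x" if "b \<in> G" "y \<le> b" for b
    using that by (intro majorant_extension_greatest assms) (simp add: diff_le_eq)
  then have "?S (x + y) - ?S x \<le> ?S y"
    by (intro majorant_extension_greatest assms) (simp add: diff_le_eq add.commute)
  then show ?thesis by (simp add: diff_le_eq add.commute)
qed

lemma majorant_extension_scaleR_le:
  fixes G :: "'e::ordered_real_vector set"
    and T :: "'e \<Rightarrow> 'f::{ordered_real_vector, conditionally_complete_lattice}"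
  assumes "subspace G" "majorizing G" "mono_on G T" "sublinear_on G T" "0 < c"
  shows "majorant_extension G T (c *\<^sub>R x) \<le> c *\<^sub>R majorant_extension G T x"
proof -
  let ?S = "majorant_extension G T"
  have "?S (c *\<^sub>R x) /\<^sub>R c \<le> ?S x"
  proof (rule majorant_extension_greatest[OF assms(2)])
    fix a assume a: "a \<in> G" "x \<le> a"
    have "?S (c *\<^sub>R x) \<le> T (c *\<^sub>R a)"
      using a assms by (intro majorant_extension_lower subspace_scale scaleR_left_mono) auto
    also have "\<dots> = c *\<^sub>R T a"
      using a assms(4,5) unfolding sublinear_on_def by simp
    finally show "?S (c *\<^sub>R x) /\<^sub>R c \<le> T a"
      using assms(5) by (simp add: pos_divideR_le_eq)
  qed
  then show ?thesis
    using assms(5) by (simp add: pos_divideR_le_eq)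
qed

text \<open>Scaling by a positive real is invertible, so the inequality for \<open>inverse c\<close> yields the
  reverse inequality for \<open>c\<close>.\<close>

lemma majorant_extension_scaleR:
  fixes G :: "'e::ordered_real_vector set"
    and T :: "'e \<Rightarrow> 'f::{ordered_real_vector, conditionally_complete_lattice}"
  assumes "subspace G" "majorizing G" "mono_on G T" "sublinear_on G T" "0 \<le> c"
  shows "majorant_extension G T (c *\<^sub>R x) = c *\<^sub>R majorant_extension G T x"
proof (cases "c = 0")
  case True
  then show ?thesis
    using majorant_extension_eq_on[OF assms(1-3) subspace_0[OF assms(1)]]
      sublinear_on_zero[OF assms(1,4)] by simp
next
  case False
  with assms(5) have c: "0 < c" by simp
  have "majorant_extension G T x \<le> majorant_extension G T (c *\<^sub>R x) /\<^sub>R c"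
    using majorant_extension_scaleR_le[OF assms(1-4), of "inverse c" "c *\<^sub>R x"] c by simp
  then have "c *\<^sub>R majorant_extension G T x \<le> majorant_extension G T (c *\<^sub>R x)"
    using c by (simp add: pos_le_divideR_eq)
  then show ?thesis
    using majorant_extension_scaleR_le[OF assms(1-4) c] by (intro antisym)
qed

theorem theorem3p7:
  fixes G :: "'e::ordered_real_vector set"
    and T :: "'e \<Rightarrow> 'f::{ordered_real_vector, conditionally_complete_lattice}"
  assumes "subspace G"
    and "majorizing G"
    and "mono_on G T"
    and "sublinear_on G T"
  shows "\<exists>S :: 'e \<Rightarrow> 'f. (\<forall>x\<in>G. S x = T x) \<and> sublinear_on UNIV S \<and> positive_on UNIV S"
proof (intro exI conjI)
  let ?S = "majorant_extension G T"
  show "\<forall>x\<in>G. ?S x = T x"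
    using majorant_extension_eq_on[OF assms(1-3)] by blast
  show "sublinear_on UNIV ?S"
    unfolding sublinear_on_def
    using majorant_extension_add_le[OF assms] majorant_extension_scaleR[OF assms] by blast
  show "positive_on UNIV ?S"
    unfolding positive_on_def
  proof (intro ballI impI majorant_extension_greatest[OF assms(2)])
    fix x y :: 'e assume "0 \<le> x" "y \<in> G" "x \<le> y"
    then have "T 0 \<le> T y"
      using subspace_0[OF assms(1)] by (intro mono_onD[OF assms(3)]) auto
    then show "0 \<le> T y"
      using sublinear_on_zero[OF assms(1,4)] by simp
  qed
qed

end
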